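(* Let $\beta\in\mathcal{B}_2\setminus\mathcal{B}_1$, let $\rho$ be a regularizing function for $\beta$, with associated deformed sequence $\beta(\Lambda)$, singular part $r(\Lambda)$ and constant $\kappa\in\mathbb{R}$ (so that $\sum_{j\ge 1}1/\beta_j(\Lambda)=r(\Lambda)+\kappa+o(1)$ as $\Lambda\to+\infty$). Then the function $\Phi(s,\beta(\Lambda))$, $s\in\mathbb{R}$, is renormalizable, and the renormalization is achieved by a change of the phase multiplier only: for every $\theta\in\mathbb{R}$ the transition $$\Phi(s,\beta(\Lambda))\;\to\;\Phi(s,\beta(\Lambda))\,e^{-is(r(\Lambda)+\theta)/2}$$ (that is, $h_2=-s(r(\Lambda)+\theta)/2$ and $h_i=0$ for all $i\neq 2$) is a renormalization, with $\theta$ a free parameter. Moreover, for every $s\in\mathbb{R}$ and $\theta\in\mathbb{R}$, $$\lim_{\Lambda\to+\infty}\Phi(s,\beta(\Lambda))\,e^{-is(r(\Lambda)+\theta)/2}= f(s)\exp\Big(-\frac{i}{2}\big(s\theta+g_{\mathrm r}(s)\big)\Big),$$ where $$f(s)=\prod_{j=1}^{+\infty}\Big(1+\frac{s^2}{\beta_j^2}\Big)^{-1/4},\qquad g_{\mathrm r}(s)=-s\kappa+s^3\int_0^1\mathrm{d}t\,\sum_{j=1}^{+\infty}\frac{t^2\beta_j^{-3}}{1+s^2t^2/\beta_j^2}.$$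
   Context: For $k\in\mathbb{N}=\{1,2,\dots\}$, $\mathcal{B}_k$ is the set of real sequences $\beta=\{\beta_j\}_{j=1}^{+\infty}$ with $\beta_j>0$ for all $j$ and $b_k(\beta)=\sum_{j=1}^{+\infty}\beta_j^{-k}<+\infty$. For $n\in\mathbb{N}$, $s\in\mathbb{R}$, $$\Phi_n(s,\beta)=\prod_{j=1}^{n}\int_{\mathbb{R}}\frac{\mathrm{d}a_j}{\sqrt{\pi/\beta_j}}\,e^{-\beta_j a_j^2+isa_j^2},$$ and $\Phi(s,\beta)=\lim_{n\to+\infty}\Phi_n(s,\beta)$ when this limit exists. Regularizing function: for $\beta\in\mathcal{B}_2\setminus\mathcal{B}_1$ it is a continuous function $\rho:[0,+\infty)\to[0,1]$ with $\rho(0)=1$ such that, putting $\beta_j(\Lambda)=\beta_j/\rho\big(\sqrt{\beta_j/\Lambda}\big)$, for all $\Lambda$ larger than some fixed value one has $$\sum_{j=1}^{+\infty}\frac{1}{\beta_j(\Lambda)}=r(\Lambda)+\kappa+o(1)<+\infty\quad(\Lambda\to+\infty),$$ where $r(\Lambda)$ is a real function (the singular part) tending to $+\infty$ as $\Lambda\to+\infty$, and $\kappa\in\mathbb{R}$ does not depend on $\Lambda$. If $\rho(\sqrt{\beta_j/\Lambda})=0$ then $1/\beta_j(\Lambda)=0$ by convention and the $j$-th factor in $\Phi_n(s,\beta(\Lambda))$ is $1$. The regularized sequence is $\beta(\Lambda)=\{\beta_j(\Lambda)\}_{j\ge1}$. Removing the regularization means taking $\Lambda\to+\infty$. Renormalizable: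 $\Phi(s,\beta(\Lambda))$ is called renormalizable if there are real functions $h_i=h_i(\Lambda,s,\beta)$, $i\in\mathbb{N}$, such that $$e^{h_1+ih_2}\,\Phi\big(s+h_3,\{\beta_j(\Lambda)+h_{3+j}\}_{j=1}^{+\infty}\big)$$ has a finite limit as $\Lambda\to+\infty$, where every $h_i$ that is not identically zero diverges as $\Lambda\to+\infty$ for each fixed $s\ne0$ and tends to $0$ as $s\to0$ for each fixed $\Lambda$. *)

theory Defs
  imports "HOL-Analysis.Analysis"
begin

text \<open>
  Sequences indexed by $j = 1, 2, \ldots$ are functions on \<^typ>\<open>nat\<close>, with argument \<open>j\<close> standing
  for the index \<open>j + 1\<close>.
\<close>

definition seq_class :: "nat \<Rightarrow> (nat \<Rightarrow> real) set" where
  "seq_class k = {\<beta>. (\<forall>j. 0 < \<beta> j) \<and> summable (\<lambda>j. 1 / \<beta> j ^ k)}"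

text \<open>
  Regularized sequences may take the value \<open>\<infinity>\<close>, so \<open>\<Phi>\<close> is defined on extended real sequences;
  by convention an infinite entry contributes the factor \<open>1\<close>.  Only positive entries are meaningful.
\<close>

definition Phi_factor :: "real \<Rightarrow> ereal \<Rightarrow> complex" where
  "Phi_factor s b =
     (if b = \<infinity> then 1
      else let c = real_of_ereal b in
        LBINT a. exp (complex_of_real (- c * a\<^sup>2) + \<i> * complex_of_real (s * a\<^sup>2))
                   / complex_of_real (sqrt (pi / c)))"

definition Phi_n :: "nat \<Rightarrow> real \<Rightarrow> (nat \<Rightarrow> ereal) \<Rightarrow> complex" where
  "Phi_n n s b = (\<Prod>j<n. Phi_factor s (b j))"

definition Phi_exists :: "real \<Rightarrow> (nat \<Rightarrow> ereal) \<Rightarrow> bool" where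
  "Phi_exists s b \<longleftrightarrow> (\<forall>j. 0 < b j) \<and> convergent (\<lambda>n. Phi_n n s b)"

definition Phi :: "real \<Rightarrow> (nat \<Rightarrow> ereal) \<Rightarrow> complex" where
  "Phi s b = lim (\<lambda>n. Phi_n n s b)"

text \<open>
  The division is that of \<^typ>\<open>ereal\<close>: for \<open>\<beta> j > 0\<close> the value is \<open>\<infinity>\<close> where \<open>\<rho>\<close> vanishes, and
  then \<open>1 / \<infinity> = 0\<close>.
\<close>

definition reg_seq :: "(real \<Rightarrow> real) \<Rightarrow> (nat \<Rightarrow> real) \<Rightarrow> real \<Rightarrow> nat \<Rightarrow> ereal" where
  "reg_seq \<rho> \<beta> \<Lambda> j = ereal (\<beta> j) / ereal (\<rho> (sqrt (\<beta> j / \<Lambda>)))"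

lemma reg_seq_eq:
  assumes "0 < \<beta> j"
  shows "reg_seq \<rho> \<beta> \<Lambda> j =
           (if \<rho> (sqrt (\<beta> j / \<Lambda>)) = 0 then \<infinity> else ereal (\<beta> j / \<rho> (sqrt (\<beta> j / \<Lambda>))))"
  using assms by (simp add: reg_seq_def divide_ereal_def divide_inverse)

lemma inverse_reg_seq:
  assumes "0 < \<beta> j"
  shows "1 / reg_seq \<rho> \<beta> \<Lambda> j = ereal (\<rho> (sqrt (\<beta> j / \<Lambda>)) / \<beta> j)"
  using assms by (simp add: reg_seq_eq divide_ereal_def one_ereal_def divide_inverse)

text \<open>\<open>\<rho>\<close> is a regularizing function for \<open>\<beta>\<close>, with singular part \<open>r\<close> and constant \<open>\<kappa>\<close>.\<close>

definition regularizing ::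
    "(nat \<Rightarrow> real) \<Rightarrow> (real \<Rightarrow> real) \<Rightarrow> (real \<Rightarrow> real) \<Rightarrow> real \<Rightarrow> bool" where
  "regularizing \<beta> \<rho> r \<kappa> \<longleftrightarrow>
     continuous_on {0..} \<rho> \<and> \<rho> ` {0..} \<subseteq> {0..1} \<and> \<rho> 0 = 1 \<and>
     (\<forall>\<^sub>F \<Lambda> in at_top. summable (\<lambda>j. real_of_ereal (1 / reg_seq \<rho> \<beta> \<Lambda> j))) \<and>
     ((\<lambda>\<Lambda>. (\<Sum>j. real_of_ereal (1 / reg_seq \<rho> \<beta> \<Lambda> j)) - (r \<Lambda> + \<kappa>)) \<longlongrightarrow> 0) at_top \<and>
     filterlim r at_top at_top"

text \<open>
  \<open>b \<Lambda>\<close> is the regularized sequence and \<open>h i \<Lambda> s\<close> is $h_i(\Lambda,s,\beta)$ for \<open>i \<ge> 1\<close>, with \<open>\<beta>\<close>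
  fixed; \<open>h 0\<close> is unused.  With the index shift above, $h_{3+j}$ acting on the \<open>j\<close>-th entry becomes
  \<open>h (4 + j)\<close> acting on \<open>b \<Lambda> j\<close>.  Divergence means divergence to infinity in absolute value.
\<close>

definition renormalization ::
    "(real \<Rightarrow> nat \<Rightarrow> ereal) \<Rightarrow> (nat \<Rightarrow> real \<Rightarrow> real \<Rightarrow> real) \<Rightarrow> bool" where
  "renormalization b h \<longleftrightarrow>
     (\<forall>s. (\<forall>\<^sub>F \<Lambda> in at_top.
             Phi_exists (s + h 3 \<Lambda> s) (\<lambda>j. b \<Lambda> j + ereal (h (4 + j) \<Lambda> s))) \<and>
          (\<exists>L. ((\<lambda>\<Lambda>. exp (complex_of_real (h 1 \<Lambda> s) + \<i> * complex_of_real (h 2 \<Lambda> s)) *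
                       Phi (s + h 3 \<Lambda> s) (\<lambda>j. b \<Lambda> j + ereal (h (4 + j) \<Lambda> s)))
                \<longlongrightarrow> L) at_top)) \<and>
     (\<forall>i\<ge>1. (\<exists>\<Lambda> s. h i \<Lambda> s \<noteq> 0) \<longrightarrow>
        (\<forall>s. s \<noteq> 0 \<longrightarrow> filterlim (\<lambda>\<Lambda>. h i \<Lambda> s) at_infinity at_top) \<and>
        (\<forall>\<Lambda>. ((\<lambda>s. h i \<Lambda> s) \<longlongrightarrow> 0) (at 0)))"

definition renormalizable :: "(real \<Rightarrow> nat \<Rightarrow> ereal) \<Rightarrow> bool" where
  "renormalizable b \<longleftrightarrow> (\<exists>h. renormalization b h)"

definition limit_modulus :: "(nat \<Rightarrow> real) \<Rightarrow> real \<Rightarrow> real" where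
  "limit_modulus \<beta> s = (\<Prod>j. (1 + s\<^sup>2 / (\<beta> j)\<^sup>2) powr (- 1 / 4))"

definition reg_phase :: "(nat \<Rightarrow> real) \<Rightarrow> real \<Rightarrow> real \<Rightarrow> real" where
  "reg_phase \<beta> \<kappa> s =
     - s * \<kappa> + s ^ 3 * (LBINT t:{0..1}. (\<Sum>j. (t\<^sup>2 / \<beta> j ^ 3) / (1 + s\<^sup>2 * t\<^sup>2 / (\<beta> j)\<^sup>2)))"

end

theory Submission
  imports Defs "HOL-Probability.Distributions" "HOL-Real_Asymp.Real_Asymp"
begin

text \<open>
  A factor of \<open>\<Phi>\<close> is a complex Gaussian integral, equal to \<open>exp (L (s / c))\<close> with
  \<open>L u = - ln (1 + u\<^sup>2) / 4 + \<i> arctan u / 2\<close>.  Since \<open>L u - \<i> u / 2 = O(u\<^sup>2)\<close>, the sum of these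
  remainders over the regularized sequence is dominated by the convergent series of
  \<open>s\<^sup>2 / \<beta>\<^sub>j\<^sup>2\<close>, uniformly in \<open>\<Lambda>\<close>, and converges termwise as \<open>\<Lambda> \<rightarrow> \<infinity>\<close>.  The linear part
  \<open>\<i> u / 2\<close> is the only divergent one and sums to \<open>\<i> s (r \<Lambda> + \<kappa> + o(1)) / 2\<close>, which the phase
  multiplier cancels.
\<close>

section \<open>Complex Gaussian integrals\<close>

text \<open>Variance \<open>1 / (2 * c)\<close> produces the exponent -c x^2, so integrability and
  the value of the real Gaussian integral can be taken from moments of the normal
  distribution.\<close>

lemma normal_density_rate:
  assumes "c > 0"
  shows "normal_density 0 (1 / sqrt (2 * c)) x = sqrt (c / pi) * exp (- (c * x\<^sup>2))"
  using assms by (simp add: normal_density_def power_divide real_sqrt_divide field_simps)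

lemma integrable_power_gaussian:
  assumes "c > 0"
  shows "integrable lborel (\<lambda>x::real. x ^ k * exp (- (c * x\<^sup>2)))"
proof -
  have "integrable lborel (\<lambda>x. normal_density 0 (1 / sqrt (2 * c)) x * (x - 0) ^ k)"
    using assms by (intro integrable_normal_moment) simp
  then have "integrable lborel (\<lambda>x. sqrt (c / pi) * (x ^ k * exp (- (c * x\<^sup>2))))"
    unfolding normal_density_rate[OF assms] by (simp add: mult_ac)
  then show ?thesis
    using assms by (simp add: integrable_mult_right_iff)
qed

lemma integral_gaussian_real:
  assumes "c > 0"
  shows "(LBINT x::real. exp (- (c * x\<^sup>2))) = sqrt (pi / c)"
proof -
  have "(LBINT x::real. sqrt (c / pi) * exp (- (c * x\<^sup>2))) = 1"
    using integral_normal_density[of "1 / sqrt (2 * c)" 0] assms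
    by (simp add: normal_density_rate[OF assms])
  then have "sqrt (c / pi) * (LBINT x::real. exp (- (c * x\<^sup>2))) = 1"
    by simp
  then show ?thesis
    using assms by (simp add: real_sqrt_divide field_simps)
qed

text \<open>The modulus of the exponential depends only on \<open>Re z\<close>, so the real Gaussian
  with rate \<open>Re z\<close> dominates.\<close>

lemma integrable_power_gaussian_complex:
  assumes "Re z > 0"
  shows "integrable lborel (\<lambda>a::real. of_real (a ^ k) * exp (- (z * of_real (a\<^sup>2))))"
proof (rule Bochner_Integration.integrable_bound)
  show "integrable lborel (\<lambda>x::real. x ^ k * exp (- (Re z * x\<^sup>2)))"
    using assms by (rule integrable_power_gaussian)
qed (auto simp: norm_mult norm_exp_eq_Re norm_power simp flip: of_real_power)

text \<open>The function a exp(-z a^2) vanishes at both ends of the line, so its derivative, exp(-z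
  a^2) minus 2 z a^2 exp(-z a^2), has integral 0.\<close>

lemma integral_gaussian_by_parts:
  assumes "Re z > 0"
  shows "(LBINT a::real. exp (- (z * of_real (a\<^sup>2)))) =
         2 * z * (LBINT a::real. of_real (a\<^sup>2) * exp (- (z * of_real (a\<^sup>2))))"
proof -
  define e where "e a = exp (- (z * of_real (a\<^sup>2)))" for a :: real
  define F where "F a = of_real a * e a" for a :: real
  have int: "integrable lborel e" "integrable lborel (\<lambda>a. of_real (a\<^sup>2) * e a)"
    using integrable_power_gaussian_complex[OF assms, of 0]
      integrable_power_gaussian_complex[OF assms, of 2] by (simp_all add: e_def[abs_def])
  have norm_F: "norm (F a) = \<bar>a * exp (- (Re z * a\<^sup>2))\<bar>" for a
    by (simp add: F_def e_def norm_mult norm_exp_eq_Re abs_mult flip: of_real_power)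
  have "((\<lambda>a. a * exp (- (Re z * a\<^sup>2))) \<longlongrightarrow> 0) at_top"
    "((\<lambda>a. a * exp (- (Re z * a\<^sup>2))) \<longlongrightarrow> 0) at_bot"
    using assms by real_asymp+
  then have "(F \<longlongrightarrow> 0) at_top" "(F \<longlongrightarrow> 0) at_bot"
    by (auto simp: norm_F intro: tendsto_norm_zero_cancel intro!: tendsto_rabs_zero)
  then have "(LBINT a=-\<infinity>..\<infinity>. e a - 2 * z * (of_real (a\<^sup>2) * e a)) = 0 - 0"
  proof (intro interval_integral_FTC_integrable[where F = F])
    show "(F has_vector_derivative e x - 2 * z * (of_real (x\<^sup>2) * e x)) (at x)" for x
    proof -
      have "((\<lambda>w. w * exp (- (z * w\<^sup>2))) has_field_derivative e x - 2 * z * (of_real (x\<^sup>2) * e x))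
          (at (of_real x))"
        unfolding e_def
        by (auto intro!: derivative_eq_intros simp: power2_eq_square algebra_simps)
      from has_vector_derivative_real_field[OF this] show ?thesis
        by (simp add: F_def[abs_def] e_def)
    qed
    show "isCont (\<lambda>a. e a - 2 * z * (of_real (a\<^sup>2) * e a)) x" for x
      unfolding e_def by (intro continuous_intros)
    show "set_integrable lborel (einterval (- \<infinity>) \<infinity>) (\<lambda>a. e a - 2 * z * (of_real (a\<^sup>2) * e a))"
      using int by (simp add: set_integrable_def)
  qed (simp_all add: ereal_tendsto_simps)
  then have "(LBINT a. e a - 2 * z * (of_real (a\<^sup>2) * e a)) = 0"
    by (simp add: interval_lebesgue_integral_def set_lebesgue_integral_def)
  then show ?thesis
    using int unfolding e_def[symmetric] by simp
qed

text \<open>Differentiation under the integral sign: the mean value inequality bounds the difference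
  quotients by an integrable Gaussian moment, and dominated convergence applies.\<close>

lemma has_field_derivative_integral_gaussian:
  assumes "Re z > 0"
  shows "((\<lambda>z. LBINT a::real. exp (- (z * of_real (a\<^sup>2)))) has_field_derivative
          - (LBINT a::real. of_real (a\<^sup>2) * exp (- (z * of_real (a\<^sup>2))))) (at z)"
proof -
  define K where "K z = (LBINT a::real. exp (- (z * of_real (a\<^sup>2))))" for z :: complex
  \<comment> \<open>On this half-plane the decay rate is at least \<open>Re z / 2\<close>, which
    gives one majorant for all nearby points; convexity is needed for the mean value
    inequality.\<close>
  define S where "S = {w. Re w > Re z / 2}"
  have S: "open S" "convex S" "z \<in> S"
    using open_halfspace_Re_gt[of "Re z / 2"] convex_halfspace_Re_gt[of "Re z / 2"] assms
    by (simp_all only: S_def) simp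
  have deriv: "((\<lambda>w. exp (- (w * of_real (a\<^sup>2)))) has_field_derivative
      - of_real (a\<^sup>2) * exp (- (w * of_real (a\<^sup>2)))) (at w within T)" for a :: real and w T
    by (auto intro!: derivative_eq_intros)
  have "((\<lambda>w. (K w - K z) / (w - z)) \<longlongrightarrow>
      (LBINT a::real. - of_real (a\<^sup>2) * exp (- (z * of_real (a\<^sup>2))))) (at z within S)"
    \<comment> \<open>Dominated convergence is a statement about sequences, so the limit is tested
      along an arbitrary sequence in \<open>S - {z}\<close>.\<close>
    unfolding tendsto_at_iff_sequentially
  proof (intro allI impI)
    fix X assume X: "\<forall>i. X i \<in> S - {z}" "X \<longlonglongrightarrow> z"
    define q where "q i a = (exp (- (X i * of_real (a\<^sup>2))) - exp (- (z * of_real (a\<^sup>2)))) / (X i - z)"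
      for i and a :: real
    have int: "integrable lborel (\<lambda>a::real. exp (- (w * of_real (a\<^sup>2))))" if "w \<in> S" for w
      using integrable_power_gaussian_complex[of w 0] that assms by (simp add: S_def)
    have "(K (X i) - K z) / (X i - z) = (LBINT a. q i a)" for i
      using X(1) S(3) int by (auto simp: q_def K_def integral_diff)
    moreover have "(\<lambda>i. LBINT a. q i a) \<longlonglongrightarrow>
        (LBINT a::real. - of_real (a\<^sup>2) * exp (- (z * of_real (a\<^sup>2))))"
    proof (rule integral_dominated_convergence)
      show "integrable lborel (\<lambda>a::real. a ^ 2 * exp (- (Re z / 2 * a\<^sup>2)))"
        using assms by (intro integrable_power_gaussian) simp
      show "AE a in lborel. norm (q i a) \<le> a\<^sup>2 * exp (- (Re z / 2 * a\<^sup>2))" for i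
      proof (intro AE_I2)
        fix a :: real
        have "norm (exp (- (X i * of_real (a\<^sup>2))) - exp (- (z * of_real (a\<^sup>2)))) \<le>
            a\<^sup>2 * exp (- (Re z / 2 * a\<^sup>2)) * norm (X i - z)"
        proof (rule field_differentiable_bound[OF S(2) deriv])
          show "norm (- of_real (a\<^sup>2) * exp (- (w * of_real (a\<^sup>2)))) \<le> a\<^sup>2 * exp (- (Re z / 2 * a\<^sup>2))"
            if "w \<in> S" for w
          proof -
            have "Re z / 2 * a\<^sup>2 \<le> Re w * a\<^sup>2"
              using that by (intro mult_right_mono) (auto simp: S_def)
            then show ?thesis
              by (auto simp: norm_mult norm_exp_eq_Re intro!: mult_left_mono simp flip: of_real_power)
          qed
        qed (use X(1) S(3) in auto)
        then show "norm (q i a) \<le> a\<^sup>2 * exp (- (Re z / 2 * a\<^sup>2))"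
          using X(1) by (simp add: q_def norm_divide divide_le_eq)
      qed
      show "AE a in lborel. (\<lambda>i. q i a) \<longlonglongrightarrow> - of_real (a\<^sup>2) * exp (- (z * of_real (a\<^sup>2)))"
      proof (intro AE_I2)
        fix a :: real
        show "(\<lambda>i. q i a) \<longlonglongrightarrow> - of_real (a\<^sup>2) * exp (- (z * of_real (a\<^sup>2)))"
          using deriv[of a z S] X
          unfolding has_field_derivative_iff tendsto_at_iff_sequentially q_def comp_def by blast
      qed
    qed (simp_all add: q_def)
    ultimately show "((\<lambda>w. (K w - K z) / (w - z)) \<circ> X) \<longlonglongrightarrow>
        (LBINT a::real. - of_real (a\<^sup>2) * exp (- (z * of_real (a\<^sup>2))))"
      by (simp add: comp_def)
  qed
  then have "(K has_field_derivative (LBINT a::real. - of_real (a\<^sup>2) * exp (- (z * of_real (a\<^sup>2))))) (at z within S)"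
    by (simp add: has_field_derivative_iff)
  then show ?thesis
    using at_within_open[OF S(3,1)] by (simp add: K_def[abs_def])
qed

text \<open>
  By parts, the integral \<open>K\<close> satisfies \<open>K' = - K / (2 z)\<close>, so \<open>K z * csqrt z\<close> is constant on the
  half-plane; this fixes the branch of the square root.
\<close>

lemma integral_gaussian_complex:
  assumes "Re z > 0"
  shows "(LBINT a::real. exp (- (z * of_real (a\<^sup>2)))) = of_real (sqrt pi) / csqrt z"
proof -
  define K where "K z = (LBINT a::real. exp (- (z * of_real (a\<^sup>2))))" for z :: complex
  have "((\<lambda>w. K w * csqrt w) has_field_derivative 0) (at w within {w. Re w > 0})"
    if "w \<in> {w. Re w > 0}" for w
  proof -
    have w: "Re w > 0" "w \<noteq> 0" "w \<notin> \<real>\<^sub>\<le>\<^sub>0"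
      using that by (auto simp: complex_nonpos_Reals_iff)
    have *: "K w = 2 * w * (LBINT a::real. of_real (a\<^sup>2) * exp (- (w * of_real (a\<^sup>2))))"
      unfolding K_def by (rule integral_gaussian_by_parts) fact
    have "(K has_field_derivative - (K w / (2 * w))) (at w)"
      using has_field_derivative_integral_gaussian[OF w(1)] * w(2) by (simp add: K_def[abs_def])
    from DERIV_mult[OF this has_field_derivative_csqrt[OF w(3)]]
    have "((\<lambda>w. K w * csqrt w) has_field_derivative
        - (K w / (2 * (csqrt w)\<^sup>2)) * csqrt w + inverse (2 * csqrt w) * K w) (at w)"
      by (simp add: ac_simps)
    \<comment> \<open>With \<open>w\<close> kept in the form \<open>(csqrt w)\<^sup>2\<close>, the
      cancellation is a purely rational identity in \<open>csqrt w\<close>.\<close>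
    also have "- (K w / (2 * (csqrt w)\<^sup>2)) * csqrt w + inverse (2 * csqrt w) * K w = 0"
      using w(2) by (simp add: field_simps power2_eq_square del: power2_csqrt)
    finally show ?thesis
      by (rule has_field_derivative_at_within)
  qed
  from has_field_derivative_zero_constant[OF convex_halfspace_Re_gt this]
  obtain C where C: "\<And>w. Re w > 0 \<Longrightarrow> K w * csqrt w = C"
    by auto
  \<comment> \<open>The constant is read off at the point 1, where the integral is real.\<close>
  have "K 1 = of_real (LBINT a::real. exp (- (1 * a\<^sup>2)))"
    unfolding K_def by (subst integral_complex_of_real[symmetric]) (simp flip: exp_of_real)
  also have "\<dots> = of_real (sqrt pi)"
    by (subst integral_gaussian_real) auto
  finally have "C = of_real (sqrt pi)"
    using C[of 1] by simp
  then have "K z = of_real (sqrt pi) / csqrt z"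
    using C[OF assms] assms by (subst nonzero_eq_divide_eq) auto
  then show ?thesis
    by (simp only: K_def)
qed

text \<open>The number 1 - iu lies in the right half-plane, with modulus sqrt(1 + u^2) and principal
  argument -arctan u; the principal root is the exponential of half of \<open>Ln\<close>.\<close>

lemma inverse_csqrt_one_minus_imaginary:
  "1 / csqrt (1 - \<i> * of_real u) =
     exp (of_real (- ln (1 + u\<^sup>2) / 4) + \<i> * of_real (arctan u / 2))"
proof -
  define z where "z = 1 - \<i> * of_real u"
  have z: "Re z = 1" "Im z = - u" "z \<noteq> 0"
    by (auto simp: z_def complex_eq_iff)
  have "norm z = sqrt (1 + u\<^sup>2)"
    by (simp add: cmod_def z)
  then have "Re (Ln z) = ln (1 + u\<^sup>2) / 2"
    using z(3) by (simp add: ln_sqrt sum_power2_gt_zero_iff add_pos_nonneg)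
  moreover have "Im (Ln z) = - arctan u"
    using Arg_eq_Im_Ln[OF z(3)] arg_conv_arctan[of z] by (simp add: z arctan_minus)
  ultimately have "- (Ln z / 2) = of_real (- ln (1 + u\<^sup>2) / 4) + \<i> * of_real (arctan u / 2)"
    by (simp add: complex_eq_iff)
  then show ?thesis
    using csqrt_exp_Ln[OF z(3)] unfolding z_def by (metis exp_minus inverse_eq_divide)
qed

section \<open>The logarithm of a factor\<close>

text \<open>This is -Ln(1 - iu)/2 in the principal branch. Having a fixed continuous logarithm turns
  partial products into exponentials of partial sums.\<close>

definition gauss_log :: "real \<Rightarrow> complex" where
  "gauss_log u = of_real (- ln (1 + u\<^sup>2) / 4) + \<i> * of_real (arctan u / 2)"

text \<open>The exponent has rate c - is = c(1 - is/c). A positive real factor can be pulled out of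
  the principal root, and sqrt c then cancels against the normalization.\<close>

lemma Phi_factor_ereal:
  assumes "c > 0"
  shows "Phi_factor s (ereal c) = exp (gauss_log (s / c))"
proof -
  define z where "z = Complex c (- s)"
  have z: "Re z > 0" "z = of_real c * (1 - \<i> * of_real (s / c))"
    using assms by (simp_all add: z_def complex_eq_iff)
  have "csqrt z = of_real (sqrt c) * csqrt (1 - \<i> * of_real (s / c))"
    using assms unfolding z(2)
    by (subst csqrt_mult) (auto simp: csqrt_of_real_nonneg Arg_of_real Arg_bounded)
  moreover have "Phi_factor s (ereal c) =
      (LBINT a. exp (- (z * of_real (a\<^sup>2))) / of_real (sqrt (pi / c)))"
  proof -
    have "of_real (- c * a\<^sup>2) + \<i> * of_real (s * a\<^sup>2) = - (z * of_real (a\<^sup>2))" for a :: real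
      by (simp add: z_def complex_eq_iff flip: of_real_power)
    then show ?thesis
      by (simp only: Phi_factor_def) simp
  qed
  ultimately have "Phi_factor s (ereal c) = 1 / csqrt (1 - \<i> * of_real (s / c))"
    using integral_gaussian_complex[OF z(1)] assms by (simp add: real_sqrt_divide)
  then show ?thesis
    unfolding gauss_log_def inverse_csqrt_one_minus_imaginary .
qed

text \<open>Infinite entries fit the same formula: where \<rho> vanishes, the conventional factor 1
  is the exponential of \<open>gauss_log 0\<close>, which is 0.\<close>

lemma Phi_factor_reg_seq:
  assumes "\<beta> j > 0" "\<rho> (sqrt (\<beta> j / \<Lambda>)) \<ge> 0"
  shows "Phi_factor s (reg_seq \<rho> \<beta> \<Lambda> j) = exp (gauss_log (s * (\<rho> (sqrt (\<beta> j / \<Lambda>)) / \<beta> j)))"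
proof (cases "\<rho> (sqrt (\<beta> j / \<Lambda>)) = 0")
  case True
  then show ?thesis
    using assms(1) by (simp add: reg_seq_eq Phi_factor_def gauss_log_def)
next
  case False
  then show ?thesis
    using assms by (simp add: reg_seq_eq Phi_factor_ereal)
qed

section \<open>Quadratic remainder of the logarithm and the arctangent integral\<close>

lemma arctan_diff_bound: "\<bar>arctan u - u\<bar> \<le> u\<^sup>2" for u :: real
proof -
  have pos: "\<bar>arctan u - u\<bar> \<le> u\<^sup>2" if "u \<ge> 0" for u :: real
  proof -
    have "u - arctan u \<le> u\<^sup>2"
    proof -
      \<comment> \<open>The difference between the two sides vanishes at 0, so it suffices that its
        derivative is nonnegative on the half-line.\<close>
      have "(\<lambda>u. u\<^sup>2 - u + arctan u) 0 \<le> (\<lambda>u. u\<^sup>2 - u + arctan u) u"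
      proof (rule DERIV_nonneg_imp_nondecreasing[OF that])
        fix x :: real assume "0 \<le> x"
        have "((\<lambda>u. u\<^sup>2 - u + arctan u) has_real_derivative 2 * x - 1 + 1 / (1 + x\<^sup>2)) (at x)"
          by (auto intro!: derivative_eq_intros simp: field_simps)
        \<comment> \<open>The numerator is 2x - x^2 + 2x^3; the completed square absorbs the
          negative term, leaving only nonnegative summands.\<close>
        moreover have "2 * x - 1 + 1 / (1 + x\<^sup>2) = (x * (1 + x * x) + x * (1 - x / 2)\<^sup>2 + 3/4 * x^3 ) / (1 + x\<^sup>2)"
          by (simp add: add_nonneg_eq_0_iff divide_simps) (simp add: power2_eq_square power3_eq_cube algebra_simps)
        moreover have "\<dots> \<ge> 0"
          using \<open>0 \<le> x\<close> by (intro divide_nonneg_nonneg add_nonneg_nonneg mult_nonneg_nonneg) auto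
        ultimately show "\<exists>y. ((\<lambda>u. u\<^sup>2 - u + arctan u) has_real_derivative y) (at x) \<and> 0 \<le> y"
          by auto
      qed
      then show ?thesis by simp
    qed
    moreover have "arctan u \<le> u"
      using that by (rule arctan_le_self)
    ultimately show ?thesis by simp
  qed
  \<comment> \<open>Negative arguments follow because arctan is odd.\<close>
  show ?thesis
    using pos[of u] pos[of "- u"] by (cases "u \<ge> 0") (auto simp: arctan_minus)
qed

text \<open>Only the linear term is removed. The logarithm contributes at most u^2/4 and the
  arctangent at most u^2/2, so the remainder is summable as soon as the squares are.\<close>

lemma gauss_log_bound: "norm (gauss_log u - \<i> * of_real (u / 2)) \<le> u\<^sup>2"
proof -
  have "gauss_log u - \<i> * of_real (u / 2) =
      of_real (- ln (1 + u\<^sup>2) / 4) + \<i> * of_real ((arctan u - u) / 2)"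
    by (simp add: gauss_log_def complex_eq_iff diff_divide_distrib)
  also have "norm \<dots> \<le> \<bar>- ln (1 + u\<^sup>2) / 4\<bar> + \<bar>(arctan u - u) / 2\<bar>"
    by (rule order_trans[OF norm_triangle_ineq]) (simp only: norm_mult norm_of_real norm_ii mult_1 order_refl)
  also have "\<dots> \<le> u\<^sup>2"
  proof -
    have "0 \<le> ln (1 + u\<^sup>2)" "ln (1 + u\<^sup>2) \<le> u\<^sup>2"
      by (simp_all add: ln_add_one_self_le_self)
    moreover have "\<bar>(arctan u - u) / 2\<bar> \<le> u\<^sup>2 / 2"
      using arctan_diff_bound[of u] by simp
    ultimately show ?thesis
      by linarith
  qed
  finally show ?thesis .
qed

text \<open>Links the integral in \<open>reg_phase\<close> to the phases of the factors: with x =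
  1/\<beta>_j it gives the term of index j.\<close>

lemma integral_rational_arctan:
  assumes "x > 0"
  shows "s ^ 3 * (LBINT t:{0..1}. (t\<^sup>2 * x ^ 3) / (1 + s\<^sup>2 * t\<^sup>2 * x\<^sup>2)) = s * x - arctan (s * x)"
proof (cases "s = 0")
  case False
  \<comment> \<open>The integrand has an explicit antiderivative; its denominator s^3 is why s = 0
    is treated apart.\<close>
  have "(LBINT t. (t\<^sup>2 * x ^ 3) / (1 + s\<^sup>2 * t\<^sup>2 * x\<^sup>2) * indicator {0..1} t) =
      (\<lambda>t. (t * x * s - arctan (s * t * x)) / s ^ 3) 1 - (\<lambda>t. (t * x * s - arctan (s * t * x)) / s ^ 3) 0"
  proof (rule integral_FTC_Icc_real)
    fix t :: real assume "0 \<le> t" "t \<le> 1"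
    have pos: "1 + s\<^sup>2 * t\<^sup>2 * x\<^sup>2 > 0"
      by (simp add: add_pos_nonneg)
    have "((\<lambda>t. (t * x * s - arctan (s * t * x)) / s ^ 3) has_real_derivative
        (x * s - s * x / (1 + (s * t * x)\<^sup>2)) / s ^ 3) (at t)"
      using False by (auto intro!: derivative_eq_intros simp: field_simps)
    also have "(x * s - s * x / (1 + (s * t * x)\<^sup>2)) / s ^ 3 = (t\<^sup>2 * x ^ 3) / (1 + s\<^sup>2 * t\<^sup>2 * x\<^sup>2)"
    proof -
      have "x * s - s * x / (1 + s\<^sup>2 * t\<^sup>2 * x\<^sup>2) = s ^ 3 * ((t\<^sup>2 * x ^ 3) / (1 + s\<^sup>2 * t\<^sup>2 * x\<^sup>2))"
        using pos by (simp add: field_simps power2_eq_square power3_eq_cube)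
      then show ?thesis
        using False by (simp add: power_mult_distrib)
    qed
    finally show "((\<lambda>t. (t * x * s - arctan (s * t * x)) / s ^ 3) has_real_derivative
        (t\<^sup>2 * x ^ 3) / (1 + s\<^sup>2 * t\<^sup>2 * x\<^sup>2)) (at t)" .
    show "isCont (\<lambda>t. (t\<^sup>2 * x ^ 3) / (1 + s\<^sup>2 * t\<^sup>2 * x\<^sup>2)) t"
      using pos by (intro continuous_intros) auto
  qed simp
  then show ?thesis
    using False by (simp add: set_lebesgue_integral_def mult.commute)
qed simp

section \<open>Summation and the limit\<close>

lemma Phi_n_reg_seq:
  assumes "\<And>j. \<beta> j > 0" "\<And>j. \<rho> (sqrt (\<beta> j / \<Lambda>)) \<ge> 0"
  shows "Phi_n n s (reg_seq \<rho> \<beta> \<Lambda>) = exp (\<Sum>j<n. gauss_log (s * (\<rho> (sqrt (\<beta> j / \<Lambda>)) / \<beta> j)))"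
  by (simp add: Phi_n_def Phi_factor_reg_seq assms exp_sum)

text \<open>Summability of the squares controls the remainder and summability of \<open>y\<close>
  the linear phase. Keeping the two sums separate isolates the part that diverges when the
  regularization is removed.\<close>

lemma gauss_log_sums:
  assumes "summable y" "summable (\<lambda>j. (y j)\<^sup>2)"
  shows "(\<lambda>j. gauss_log (y j)) sums
    ((\<Sum>j. gauss_log (y j) - \<i> * of_real (y j / 2)) + \<i> * of_real ((\<Sum>j. y j) / 2))"
proof -
  have "summable (\<lambda>j. gauss_log (y j) - \<i> * of_real (y j / 2))"
    using assms(2) by (rule summable_comparison_test'[OF _ gauss_log_bound])
  moreover have "(\<lambda>j. \<i> * of_real (y j / 2)) sums (\<i> * of_real ((\<Sum>j. y j) / 2) :: complex)"
    using assms(1) by (intro sums_mult sums_of_real sums_divide summable_sums)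
  ultimately show ?thesis
    using sums_add[OF summable_sums] by fastforce
qed

section \<open>Series for the limiting phase and modulus\<close>

lemma summable_inverse_cube:
  fixes \<beta> :: "nat \<Rightarrow> real"
  assumes "\<And>j. \<beta> j > 0" "summable (\<lambda>j. 1 / (\<beta> j)\<^sup>2)"
  shows "summable (\<lambda>j. 1 / \<beta> j ^ 3)"
proof -
  have "(\<lambda>j. 1 / (\<beta> j)\<^sup>2) \<longlonglongrightarrow> 0"
    by (rule summable_LIMSEQ_zero) fact
  \<comment> \<open>The terms tend to 0, so eventually \<beta>_j > 1, and from there on the inverse
    cube lies below the inverse square.\<close>
  then have "eventually (\<lambda>j. 1 / (\<beta> j)\<^sup>2 < 1) sequentially"
    by (rule order_tendstoD) simp
  then have "eventually (\<lambda>j. norm (1 / \<beta> j ^ 3) \<le> 1 / (\<beta> j)\<^sup>2) sequentially"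
  proof eventually_elim
    case (elim j)
    then have "1 < (\<beta> j)\<^sup>2"
      using assms(1)[of j] by simp
    then have "1 \<le> \<beta> j"
      using assms(1)[of j] power_less_imp_less_base[of 1 2 "\<beta> j"] by simp
    then have "(\<beta> j)\<^sup>2 \<le> \<beta> j ^ 3"
      by (intro power_increasing) auto
    then show ?case
      using assms(1)[of j] by (simp add: frac_le)
  qed
  then show ?thesis
    by (rule summable_comparison_test_ev) fact
qed

text \<open>Sum and integral are exchanged, with \<beta>_j^(-3) as a bound uniform on the unit
  interval. Adding \<open>s * \<kappa>\<close> cancels the term of \<open>reg_phase\<close>
  containing \<kappa>, so \<kappa> is arbitrary here.\<close>

lemma reg_phase_sums:
  assumes "\<And>j. \<beta> j > 0" "summable (\<lambda>j. 1 / (\<beta> j)\<^sup>2)"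
  shows "(\<lambda>j. s / \<beta> j - arctan (s / \<beta> j)) sums (reg_phase \<beta> \<kappa> s + s * \<kappa>)"
proof -
  define f where "f j t = indicator {0..1} t *\<^sub>R ((t\<^sup>2 / \<beta> j ^ 3) / (1 + s\<^sup>2 * t\<^sup>2 / (\<beta> j)\<^sup>2))"
    for j and t :: real
  have sum3: "summable (\<lambda>j. 1 / \<beta> j ^ 3)"
    using assms by (rule summable_inverse_cube)
  have bound: "norm (f j t) \<le> indicator {0..1} t * (1 / \<beta> j ^ 3)" for j t
  proof (cases "t \<in> {0..1}")
    case True
    have "(t\<^sup>2 / \<beta> j ^ 3) / (1 + s\<^sup>2 * t\<^sup>2 / (\<beta> j)\<^sup>2) \<le> (1 / \<beta> j ^ 3) / 1"
      using True assms(1)[of j] by (intro frac_le divide_right_mono) (auto intro: power_le_one)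
    moreover have "(t\<^sup>2 / \<beta> j ^ 3) / (1 + s\<^sup>2 * t\<^sup>2 / (\<beta> j)\<^sup>2) \<ge> 0"
      using assms(1)[of j] by (intro divide_nonneg_nonneg add_nonneg_nonneg) auto
    ultimately show ?thesis
      using True by (simp only: f_def indicator_simps scaleR_one mult_1 real_norm_def abs_of_nonneg)
  qed (simp add: f_def)
  have int_bound: "integrable lborel (\<lambda>t::real. indicator {0..1} t * (1 / \<beta> j ^ 3))" for j
    by simp
  have meas: "f j \<in> borel_measurable lborel" for j
    unfolding f_def[abs_def] by measurable
  have int: "integrable lborel (f j)" for j
    using bound[of j] assms(1)[of j]
    by (intro Bochner_Integration.integrable_bound[OF int_bound[of j] meas]) (auto intro!: AE_I2)
  have "(\<lambda>j. integral\<^sup>L lborel (f j)) sums (LBINT t. (\<Sum>j. f j t))"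
  proof (rule sums_integral[OF int])
    show "AE t in lborel. summable (\<lambda>j. norm (f j t))"
    proof (intro AE_I2)
      fix t :: real
      have "summable (\<lambda>j. indicator {0..1} t * (1 / \<beta> j ^ 3))"
        using sum3 by (rule summable_mult)
      then show "summable (\<lambda>j. norm (f j t))"
        by (rule summable_comparison_test'[where N = 0]) (use bound in simp)
    qed
    show "summable (\<lambda>j. LBINT t. norm (f j t))"
    proof (rule summable_comparison_test'[OF sum3, where N = 0])
      fix j
      have "(LBINT t. norm (f j t)) \<le> (LBINT t::real. indicator {0..1} t * (1 / \<beta> j ^ 3))"
        using int bound by (intro integral_mono int_bound) auto
      then show "norm (LBINT t. norm (f j t)) \<le> 1 / \<beta> j ^ 3"
        by simp
    qed
  qed
  then have "(\<lambda>j. s ^ 3 * integral\<^sup>L lborel (f j)) sums (s ^ 3 * (LBINT t. (\<Sum>j. f j t)))"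
    by (rule sums_mult)
  moreover have "s ^ 3 * integral\<^sup>L lborel (f j) = s / \<beta> j - arctan (s / \<beta> j)" for j
    using integral_rational_arctan[of "1 / \<beta> j" s] assms(1)[of j]
    by (simp add: f_def[abs_def] set_lebesgue_integral_def power_divide)
  moreover have "(\<Sum>j. f j t) =
      indicator {0..1} t *\<^sub>R (\<Sum>j. (t\<^sup>2 / \<beta> j ^ 3) / (1 + s\<^sup>2 * t\<^sup>2 / (\<beta> j)\<^sup>2))" for t
    by (auto simp: f_def indicator_def)
  ultimately show ?thesis
    by (simp add: reg_phase_def set_lebesgue_integral_def)
qed

lemma summable_ln_one_plus:
  fixes y :: "nat \<Rightarrow> real"
  assumes "summable (\<lambda>j. (y j)\<^sup>2)"
  shows "summable (\<lambda>j. ln (1 + (y j)\<^sup>2))"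
  using assms
  by (rule summable_comparison_test'[where N = 0]) (simp add: ln_add_one_self_le_self)

lemma limit_modulus_eq:
  assumes "\<And>j. \<beta> j > 0" "summable (\<lambda>j. 1 / (\<beta> j)\<^sup>2)"
  shows "limit_modulus \<beta> s = exp (\<Sum>j. - ln (1 + (s / \<beta> j)\<^sup>2) / 4)"
proof -
  have "(1 + s\<^sup>2 / (\<beta> j)\<^sup>2) powr (- 1 / 4) = exp (- ln (1 + (s / \<beta> j)\<^sup>2) / 4)" for j
  proof -
    have "1 + (s / \<beta> j)\<^sup>2 > 0"
      by (simp add: add_pos_nonneg)
    then show ?thesis
      by (simp add: powr_def power_divide)
  qed
  moreover have "summable (\<lambda>j. (s / \<beta> j)\<^sup>2)"
    using summable_mult[OF assms(2), of "s\<^sup>2"] by (simp add: power_divide)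
  ultimately show ?thesis
    unfolding limit_modulus_def
    by (simp add: prodinf_exp summable_ln_one_plus summable_minus summable_divide)
qed

text \<open>The real parts of the remainders sum to the logarithm of the modulus, the imaginary
  parts to -1/2 times the series in \<open>reg_phase_sums\<close>.\<close>

lemma exp_suminf_gauss_log:
  assumes "\<And>j. \<beta> j > 0" "summable (\<lambda>j. 1 / (\<beta> j)\<^sup>2)"
  shows "exp (\<Sum>j. gauss_log (s / \<beta> j) - \<i> * of_real (s / \<beta> j / 2)) =
    of_real (limit_modulus \<beta> s) * exp (- (\<i> / 2) * of_real (reg_phase \<beta> \<kappa> s + s * \<kappa>))"
proof -
  have "summable (\<lambda>j. (s / \<beta> j)\<^sup>2)"
    using summable_mult[OF assms(2), of "s\<^sup>2"] by (simp add: power_divide)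
  then have "summable (\<lambda>j. - ln (1 + (s / \<beta> j)\<^sup>2) / 4)"
    by (intro summable_divide summable_minus summable_ln_one_plus)
  then have "(\<lambda>j. of_real (- ln (1 + (s / \<beta> j)\<^sup>2) / 4) + - (\<i> / 2) * of_real (s / \<beta> j - arctan (s / \<beta> j)))
      sums (of_real (\<Sum>j. - ln (1 + (s / \<beta> j)\<^sup>2) / 4)
        + - (\<i> / 2) * of_real (reg_phase \<beta> \<kappa> s + s * \<kappa>))"
    by (intro sums_add sums_mult sums_of_real reg_phase_sums[OF assms] summable_sums)
  moreover have "of_real (- ln (1 + u\<^sup>2) / 4) + - (\<i> / 2) * of_real (u - arctan u) =
      gauss_log u - \<i> * of_real (u / 2)" for u
    by (simp add: gauss_log_def complex_eq_iff diff_divide_distrib)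
  ultimately have "(\<Sum>j. gauss_log (s / \<beta> j) - \<i> * of_real (s / \<beta> j / 2)) =
      of_real (\<Sum>j. - ln (1 + (s / \<beta> j)\<^sup>2) / 4)
        + - (\<i> / 2) * of_real (reg_phase \<beta> \<kappa> s + s * \<kappa>)"
    by (simp only: sums_iff)
  then show ?thesis
    by (simp only: exp_add limit_modulus_eq[OF assms] of_real_exp)
qed

lemma tendsto_regularizer:
  assumes "continuous_on {0..} \<rho>" "\<rho> 0 = 1" "b > (0::real)"
  shows "((\<lambda>\<Lambda>. \<rho> (sqrt (b / \<Lambda>))) \<longlongrightarrow> (1::real)) at_top"
proof -
  have "((\<lambda>\<Lambda>. sqrt (b / \<Lambda>)) \<longlongrightarrow> 0) at_top"
    using assms(3) by real_asymp
  \<comment> \<open>Continuity of \<rho> is given only on the half-line, so the argument must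
    eventually stay in it.\<close>
  moreover have "\<forall>\<^sub>F \<Lambda> in at_top. sqrt (b / \<Lambda>) \<in> {0..}"
    using eventually_gt_at_top[of 0] by eventually_elim (use assms(3) in simp)
  ultimately have "((\<lambda>\<Lambda>. \<rho> (sqrt (b / \<Lambda>))) \<longlongrightarrow> \<rho> 0) at_top"
    by (intro continuous_on_tendsto_compose[OF assms(1)]) simp_all
  then show ?thesis
    by (simp add: assms(2))
qed

text \<open>Writes \<Phi> as the exponential of an absolutely controlled remainder plus a phase
  proportional to the sum of the inverse entries, the quantity whose growth is
  \<open>r\<close>.\<close>

lemma Phi_reg_seq:
  fixes \<beta> :: "nat \<Rightarrow> real" and \<rho> :: "real \<Rightarrow> real"
  defines "y \<equiv> \<lambda>\<Lambda> j. \<rho> (sqrt (\<beta> j / \<Lambda>)) / \<beta> j"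
  assumes "\<And>j. \<beta> j > 0" "\<And>j. 0 \<le> \<rho> (sqrt (\<beta> j / \<Lambda>))"
    and "summable (y \<Lambda>)" "summable (\<lambda>j. (s * y \<Lambda> j)\<^sup>2)"
  shows "Phi_exists s (reg_seq \<rho> \<beta> \<Lambda>)"
    and "Phi s (reg_seq \<rho> \<beta> \<Lambda>) =
      exp ((\<Sum>j. gauss_log (s * y \<Lambda> j) - \<i> * of_real (s * y \<Lambda> j / 2)) + \<i> * of_real (s * (\<Sum>j. y \<Lambda> j) / 2))"
proof -
  have "(\<lambda>n. exp (\<Sum>j<n. gauss_log (s * y \<Lambda> j))) \<longlonglongrightarrow>
      exp ((\<Sum>j. gauss_log (s * y \<Lambda> j) - \<i> * of_real (s * y \<Lambda> j / 2)) + \<i> * of_real (s * (\<Sum>j. y \<Lambda> j) / 2))"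
    using gauss_log_sums[OF summable_mult[OF assms(4)] assms(5)]
    by (intro tendsto_exp) (simp add: sums_def suminf_mult[OF assms(4)])
  then have lim: "(\<lambda>n. Phi_n n s (reg_seq \<rho> \<beta> \<Lambda>)) \<longlonglongrightarrow>
      exp ((\<Sum>j. gauss_log (s * y \<Lambda> j) - \<i> * of_real (s * y \<Lambda> j / 2)) + \<i> * of_real (s * (\<Sum>j. y \<Lambda> j) / 2))"
    unfolding Phi_n_reg_seq[of \<beta> \<rho> \<Lambda>, OF assms(2,3)] y_def .
  have "0 < reg_seq \<rho> \<beta> \<Lambda> j" for j
    using assms(2,3)[of j] by (simp add: reg_seq_eq)
  then show "Phi_exists s (reg_seq \<rho> \<beta> \<Lambda>)"
    using lim by (auto simp: Phi_exists_def convergent_def)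
  show "Phi s (reg_seq \<rho> \<beta> \<Lambda>) =
      exp ((\<Sum>j. gauss_log (s * y \<Lambda> j) - \<i> * of_real (s * y \<Lambda> j / 2)) + \<i> * of_real (s * (\<Sum>j. y \<Lambda> j) / 2))"
    unfolding Phi_def using lim by (rule limI)
qed

lemma isCont_gauss_log: "isCont gauss_log u"
proof -
  have "1 + u\<^sup>2 > 0"
    by (simp add: add_pos_nonneg)
  then show ?thesis
    unfolding gauss_log_def[abs_def] by (intro continuous_intros) auto
qed

section \<open>Removal of the regularization for a fixed sequence and regularizer\<close>

context
  fixes \<beta> :: "nat \<Rightarrow> real" and \<rho> r :: "real \<Rightarrow> real" and \<kappa> :: real
  assumes \<beta>: "\<beta> \<in> seq_class 2" and reg: "regularizing \<beta> \<rho> r \<kappa>"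
begin

lemma \<beta>_pos: "\<beta> j > 0" and summable_inverse_square: "summable (\<lambda>j. 1 / (\<beta> j)\<^sup>2)"
  using \<beta> by (auto simp: seq_class_def)

lemma regularizer_bounds: "\<Lambda> > 0 \<Longrightarrow> 0 \<le> \<rho> (sqrt (\<beta> j / \<Lambda>)) \<and> \<rho> (sqrt (\<beta> j / \<Lambda>)) \<le> 1"
proof -
  assume "\<Lambda> > 0"
  then have "sqrt (\<beta> j / \<Lambda>) \<in> {0..}"
    using \<beta>_pos[of j] by simp
  then show ?thesis
    using reg unfolding regularizing_def by (meson atLeastAtMost_iff image_subset_iff)
qed

text \<open>As \<rho> takes values in the unit interval, regularizing only shrinks the inverse
  entries; this gives a summable majorant independent of \<Lambda>.\<close>

lemma regularized_square_le:
  assumes "\<Lambda> > 0"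
  shows "(s * (\<rho> (sqrt (\<beta> j / \<Lambda>)) / \<beta> j))\<^sup>2 \<le> s\<^sup>2 * (1 / (\<beta> j)\<^sup>2)"
  unfolding power_mult_distrib power_divide using regularizer_bounds[OF assms, of j]
  by (intro mult_left_mono divide_right_mono power_le_one) auto

lemma eventually_Phi_reg_seq:
  "\<forall>\<^sub>F \<Lambda> in at_top. Phi_exists s (reg_seq \<rho> \<beta> \<Lambda>) \<and>
     Phi s (reg_seq \<rho> \<beta> \<Lambda>) =
       exp ((\<Sum>j. gauss_log (s * (\<rho> (sqrt (\<beta> j / \<Lambda>)) / \<beta> j)) - \<i> * of_real (s * (\<rho> (sqrt (\<beta> j / \<Lambda>)) / \<beta> j) / 2))
         + \<i> * of_real (s * (\<Sum>j. \<rho> (sqrt (\<beta> j / \<Lambda>)) / \<beta> j) / 2))"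
proof -
  have "\<forall>\<^sub>F \<Lambda> in at_top. summable (\<lambda>j. \<rho> (sqrt (\<beta> j / \<Lambda>)) / \<beta> j)"
    using reg by (simp add: regularizing_def inverse_reg_seq \<beta>_pos)
  then show ?thesis
    using eventually_gt_at_top[of 0]
  proof eventually_elim
    case (elim \<Lambda>)
    have "summable (\<lambda>j. (s * (\<rho> (sqrt (\<beta> j / \<Lambda>)) / \<beta> j))\<^sup>2)"
      by (rule summable_comparison_test'[OF summable_mult[OF summable_inverse_square], where N = 0])
        (use regularized_square_le[OF elim(2)] in simp)
    then show ?case
      using Phi_reg_seq[of \<beta> \<rho> \<Lambda> s] \<beta>_pos regularizer_bounds[OF elim(2)] elim(1) by blast
  qed
qed

lemma tendsto_renormalized_phase:
  "((\<lambda>\<Lambda>. (\<Sum>j. \<rho> (sqrt (\<beta> j / \<Lambda>)) / \<beta> j) - r \<Lambda>) \<longlongrightarrow> \<kappa>) at_top"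
proof -
  have "((\<lambda>\<Lambda>. (\<Sum>j. \<rho> (sqrt (\<beta> j / \<Lambda>)) / \<beta> j) - (r \<Lambda> + \<kappa>)) \<longlongrightarrow> 0) at_top"
    using reg by (simp add: regularizing_def inverse_reg_seq \<beta>_pos)
  from tendsto_add[OF this tendsto_const[of \<kappa>]] show ?thesis
    by (simp add: algebra_simps)
qed

lemma tendsto_Phi_renormalized:
  "((\<lambda>\<Lambda>. Phi s (reg_seq \<rho> \<beta> \<Lambda>) * exp (- \<i> * of_real (s * (r \<Lambda> + \<theta>) / 2)))
     \<longlongrightarrow> of_real (limit_modulus \<beta> s) *
         exp (- (\<i> / 2) * of_real (s * \<theta> + reg_phase \<beta> \<kappa> s))) at_top"
proof -
  define y where "y \<Lambda> j = \<rho> (sqrt (\<beta> j / \<Lambda>)) / \<beta> j" for \<Lambda> j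
  define G where "G u = gauss_log u - \<i> * of_real (u / 2)" for u
  have "((\<lambda>\<Lambda>. \<Sum>j. G (s * y \<Lambda> j)) \<longlongrightarrow> (\<Sum>j. G (s / \<beta> j))) at_top"
  \<comment> \<open>Tannery's theorem is dominated convergence for series; its last conclusion is
    the limit of the sums.\<close>
  proof (rule tannerys_theorem[THEN conjunct2, THEN conjunct2])
    show "((\<lambda>\<Lambda>. G (s * y \<Lambda> j)) \<longlongrightarrow> G (s / \<beta> j)) at_top" for j
    proof -
      have "((\<lambda>\<Lambda>. s * y \<Lambda> j) \<longlongrightarrow> s * (1 / \<beta> j)) at_top"
        unfolding y_def using reg \<beta>_pos[of j]
        by (intro tendsto_intros tendsto_regularizer) (auto simp: regularizing_def)
      moreover have "isCont G (s * (1 / \<beta> j))"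
        unfolding G_def by (intro continuous_intros isCont_gauss_log) auto
      ultimately show ?thesis
        using isCont_tendsto_compose by fastforce
    qed
    have "\<forall>\<^sub>F \<Lambda> in at_top. \<forall>j. norm (G (s * y \<Lambda> j)) \<le> s\<^sup>2 * (1 / (\<beta> j)\<^sup>2)"
      using eventually_gt_at_top[of 0]
    proof eventually_elim
      case (elim \<Lambda>)
      then show ?case
        unfolding G_def y_def using order_trans[OF gauss_log_bound regularized_square_le] by blast
    qed
    \<comment> \<open>The bound holds for every index at once, so the condition on the index filter
      can be taken trivial.\<close>
    then show "\<forall>\<^sub>F (j, \<Lambda>) in at_top \<times>\<^sub>F at_top. norm (G (s * y \<Lambda> j)) \<le> s\<^sup>2 * (1 / (\<beta> j)\<^sup>2)"
      unfolding eventually_prod_filter by (intro exI[of _ "\<lambda>_. True"] exI conjI) auto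
    show "summable (\<lambda>j. s\<^sup>2 * (1 / (\<beta> j)\<^sup>2))"
      by (intro summable_mult summable_inverse_square)
  qed simp
  \<comment> \<open>The multiplier is merged into the exponent before passing to the limit, so the
    divergent sum occurs only in its difference with \<open>r \<Lambda>\<close>, which tends to
    \<kappa>.\<close>
  then have "((\<lambda>\<Lambda>. exp ((\<Sum>j. G (s * y \<Lambda> j)) + (\<i> / 2) * of_real (s * (((\<Sum>j. y \<Lambda> j) - r \<Lambda>) - \<theta>))))
      \<longlongrightarrow> exp ((\<Sum>j. G (s / \<beta> j)) + (\<i> / 2) * of_real (s * (\<kappa> - \<theta>)))) at_top"
    unfolding y_def by (intro tendsto_intros tendsto_renormalized_phase)
  moreover have "\<forall>\<^sub>F \<Lambda> in at_top.
      exp ((\<Sum>j. G (s * y \<Lambda> j)) + (\<i> / 2) * of_real (s * (((\<Sum>j. y \<Lambda> j) - r \<Lambda>) - \<theta>))) =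
      Phi s (reg_seq \<rho> \<beta> \<Lambda>) * exp (- \<i> * of_real (s * (r \<Lambda> + \<theta>) / 2))"
    using eventually_Phi_reg_seq[of s]
  proof eventually_elim
    case (elim \<Lambda>)
    show ?case
      unfolding conjunct2[OF elim] y_def[symmetric] G_def[symmetric] exp_add[symmetric] mult_exp_exp
      by (rule arg_cong[where f = exp]) (simp add: field_simps)
  qed
  \<comment> \<open>The \<open>s * \<kappa>\<close> left by the linear phase cancels the one added
    to \<open>reg_phase\<close> in the remainder; only \<open>s * \<theta>\<close> survives.\<close>
  moreover have "exp ((\<Sum>j. G (s / \<beta> j)) + (\<i> / 2) * of_real (s * (\<kappa> - \<theta>))) =
      of_real (limit_modulus \<beta> s) * exp (- (\<i> / 2) * of_real (s * \<theta> + reg_phase \<beta> \<kappa> s))"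
  proof -
    have "- (\<i> / 2) * of_real (reg_phase \<beta> \<kappa> s + s * \<kappa>) + (\<i> / 2) * of_real (s * (\<kappa> - \<theta>)) =
        - (\<i> / 2) * of_real (s * \<theta> + reg_phase \<beta> \<kappa> s)"
      by (simp add: algebra_simps)
    then show ?thesis
      unfolding G_def exp_add exp_suminf_gauss_log[OF \<beta>_pos summable_inverse_square, of s \<kappa>]
      by (simp only: mult.assoc flip: exp_add)
  qed
  ultimately show ?thesis
    by (simp only: tendsto_cong)
qed

lemma renormalization_phase:
  "renormalization (reg_seq \<rho> \<beta>) (\<lambda>i \<Lambda> s. if i = 2 then - s * (r \<Lambda> + \<theta>) / 2 else 0)"
  unfolding renormalization_def
proof (intro conjI allI impI)
  fix s
  \<comment> \<open>Neither 3 nor any 4 + j equals 2, so \<open>s\<close> and all entries of the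
    sequence stay unshifted.\<close>
  show "\<forall>\<^sub>F \<Lambda> in at_top. Phi_exists (s + (if (3::nat) = 2 then - s * (r \<Lambda> + \<theta>) / 2 else 0))
      (\<lambda>j. reg_seq \<rho> \<beta> \<Lambda> j + ereal (if 4 + j = 2 then - s * (r \<Lambda> + \<theta>) / 2 else 0))"
    using eventually_Phi_reg_seq[of s] by eventually_elim (simp flip: zero_ereal_def)
  show "\<exists>L. ((\<lambda>\<Lambda>. exp (complex_of_real (if (1::nat) = 2 then - s * (r \<Lambda> + \<theta>) / 2 else 0) +
        \<i> * complex_of_real (if (2::nat) = 2 then - s * (r \<Lambda> + \<theta>) / 2 else 0)) *
      Phi (s + (if (3::nat) = 2 then - s * (r \<Lambda> + \<theta>) / 2 else 0))
       (\<lambda>j. reg_seq \<rho> \<beta> \<Lambda> j + ereal (if 4 + j = 2 then - s * (r \<Lambda> + \<theta>) / 2 else 0))) \<longlongrightarrow> L) at_top"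
    using tendsto_Phi_renormalized[of s \<theta>] by (intro exI) (simp add: mult.commute flip: zero_ereal_def)
next
  fix i :: nat and s :: real
  assume "1 \<le> i" and nz: "\<exists>\<Lambda> s. (if i = 2 then - s * (r \<Lambda> + \<theta>) / 2 else 0) \<noteq> 0" and "s \<noteq> 0"
  \<comment> \<open>A constant \<theta> does not affect the divergence of \<open>r\<close>, and the
    coefficient -s/2 is nonzero. The case \<open>i \<noteq> 2\<close> is excluded by
    \<open>nz\<close>.\<close>
  have "filterlim (\<lambda>\<Lambda>. \<theta> + r \<Lambda>) at_top at_top"
    using reg by (intro filterlim_tendsto_add_at_top[OF tendsto_const]) (simp add: regularizing_def)
  then have "filterlim (\<lambda>\<Lambda>. (- s / 2) * (\<theta> + r \<Lambda>)) at_infinity at_top"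
    using \<open>s \<noteq> 0\<close> by (intro tendsto_mult_filterlim_at_infinity[OF tendsto_const] filterlim_at_top_imp_at_infinity) auto
  then show "filterlim (\<lambda>\<Lambda>. if i = 2 then - s * (r \<Lambda> + \<theta>) / 2 else 0) at_infinity at_top"
    using nz by (auto simp: add.commute split: if_splits)
next
  fix i :: nat and \<Lambda> :: real
  show "((\<lambda>s. if i = 2 then - s * (r \<Lambda> + \<theta>) / 2 else 0) \<longlongrightarrow> 0) (at 0)"
    by (cases "i = 2") (auto intro!: tendsto_eq_intros)
qed

end

theorem theorem1:
  fixes \<beta> :: "nat \<Rightarrow> real" and \<rho> r :: "real \<Rightarrow> real" and \<kappa> :: real
  assumes "\<beta> \<in> seq_class 2 - seq_class 1"
    and "regularizing \<beta> \<rho> r \<kappa>"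
  shows "renormalizable (reg_seq \<rho> \<beta>) \<and>
    (\<forall>\<theta>. renormalization (reg_seq \<rho> \<beta>)
           (\<lambda>i \<Lambda> s. if i = 2 then - s * (r \<Lambda> + \<theta>) / 2 else 0)) \<and>
    (\<forall>s \<theta>. ((\<lambda>\<Lambda>. Phi s (reg_seq \<rho> \<beta> \<Lambda>) *
                   exp (- \<i> * complex_of_real (s * (r \<Lambda> + \<theta>) / 2)))
             \<longlongrightarrow> complex_of_real (limit_modulus \<beta> s) *
                 exp (- (\<i> / 2) * complex_of_real (s * \<theta> + reg_phase \<beta> \<kappa> s))) at_top)"
proof -
  have \<beta>: "\<beta> \<in> seq_class 2"
    using assms(1) by simp
  show ?thesis
    \<comment> \<open>Any value of \<theta> supplies a witness for the existential claim.\<close>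
    unfolding renormalizable_def
    using renormalization_phase[OF \<beta> assms(2)] tendsto_Phi_renormalized[OF \<beta> assms(2)] by blast
qed

end
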